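(* The pure braid group $\mathrm{PBr}_{I_n}$ has at least $n$ generators (i.e. every generating set of $\mathrm{PBr}_{I_n}$ has at least $n$ elements), and so $K\neq \mathrm{PBr}_{I_n}$ whenever $n\ge 4$.
   Context: Let $n\ge 2$ and let $I_n$ be the rank two Coxeter–Dynkin diagram with two nodes joined by an edge labelled $n$. Its braid group is $$B_{I_n}=\langle s_1,s_2\mid \underbrace{s_1s_2s_1\cdots}_{n}=\underbrace{s_2s_1s_2\cdots}_{n}\rangle$$ (both words alternating, of length $n$), and its Weyl group is $$W_{I_n}=\langle s_1,s_2\mid s_1^2=s_2^2=1,\ \underbrace{s_1s_2s_1\cdots}_{n}=\underbrace{s_2s_1s_2\cdots}_{n}\rangle,$$ the dihedral group of order $2n$. The pure braid group $\mathrm{PBr}_{I_n}$ is the kernel of the natural surjection $B_{I_n}\to W_{I_n}$; it is the fundamental group of the complement of the complexification of the corresponding reflection arrangement of $n$ lines in $\mathbb{R}^2$. $K\le \mathrm{PBr}_{I_n}$ is the subgroup generated by monodromy around all walls (of every codimension) of a fixed chamber of this arrangement. The chamber has two walls of codimension one and one of codimension two, so $K$ is generated by three elements, the squares of longest elements: $K=\langle s_1^2,\ s_2^2,\ \ell^2\rangle$, where $\ell=\underbrace{s_1s_2s_1\cdots}_{n}$ is the standard lift of the longest element of $W_{I_n}$. *)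

theory Defs
  imports "HOL-Algebra.Generated_Groups"
begin

section \<open>Groups given by generators and relations\<close>

text \<open>
  The generators are the elements of the type \<open>'a\<close>. A group word is a list of letters:
  \<open>(x, True)\<close> stands for the generator \<open>x\<close> and \<open>(x, False)\<close> for its formal inverse.
  A relation \<open>u = v\<close> is the pair \<open>(u, v)\<close>.
\<close>

type_synonym 'a gword = "('a \<times> bool) list"

inductive pres_eq :: "('a gword \<times> 'a gword) set \<Rightarrow> 'a gword \<Rightarrow> 'a gword \<Rightarrow> bool"
  for R :: "('a gword \<times> 'a gword) set" where
  rel: "(u, v) \<in> R \<Longrightarrow> pres_eq R u v"
| cancel: "pres_eq R [(x, b), (x, \<not> b)] []"
| refl: "pres_eq R u u"
| sym: "pres_eq R u v \<Longrightarrow> pres_eq R v u"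
| trans: "pres_eq R u v \<Longrightarrow> pres_eq R v w \<Longrightarrow> pres_eq R u w"
| append: "pres_eq R u v \<Longrightarrow> pres_eq R u' v' \<Longrightarrow> pres_eq R (u @ u') (v @ v')"

definition pres_class :: "('a gword \<times> 'a gword) set \<Rightarrow> 'a gword \<Rightarrow> 'a gword set" where
  "pres_class R u = {v. pres_eq R u v}"

definition presented_group :: "('a gword \<times> 'a gword) set \<Rightarrow> 'a gword set monoid" where
  "presented_group R =
     \<lparr>carrier = range (pres_class R),
      mult = (\<lambda>A B. \<Union>u\<in>A. \<Union>v\<in>B. pres_class R (u @ v)),
      one = pres_class R []\<rparr>"

lemma pres_class_eq_iff: "pres_class R u = pres_class R v \<longleftrightarrow> pres_eq R u v"
  unfolding pres_class_def set_eq_iff mem_Collect_eq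
  by (meson pres_eq.refl pres_eq.sym pres_eq.trans)

lemma in_pres_class: "v \<in> pres_class R u \<longleftrightarrow> pres_class R v = pres_class R u"
  unfolding pres_class_eq_iff by (simp add: pres_class_def) (metis pres_eq.sym)

lemma mult_presented_group [simp]:
  "pres_class R u \<otimes>\<^bsub>presented_group R\<^esub> pres_class R v = pres_class R (u @ v)"
proof -
  have "pres_class R (u' @ v') = pres_class R (u @ v)"
    if "u' \<in> pres_class R u" "v' \<in> pres_class R v" for u' v'
    using that by (simp add: in_pres_class pres_class_eq_iff pres_eq.append)
  moreover have "u \<in> pres_class R u" "v \<in> pres_class R v"
    by (simp_all add: in_pres_class)
  ultimately have "(\<Union>u'\<in>pres_class R u. \<Union>v'\<in>pres_class R v. pres_class R (u' @ v'))
      = pres_class R (u @ v)"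
    by blast
  then show ?thesis
    by (simp add: presented_group_def)
qed

lemma one_presented_group [simp]: "\<one>\<^bsub>presented_group R\<^esub> = pres_class R []"
  by (simp add: presented_group_def)

lemma carrier_presented_group: "carrier (presented_group R) = range (pres_class R)"
  by (simp add: presented_group_def)

lemma pres_class_closed [simp]: "pres_class R u \<in> carrier (presented_group R)"
  by (simp add: carrier_presented_group)

lemma pres_eq_inverse: "pres_eq R (rev (map (\<lambda>(x, b). (x, \<not> b)) u) @ u) []"
proof (induction u)
  case Nil
  show ?case by (simp add: pres_eq.refl)
next
  case (Cons a u)
  obtain x b where a: "a = (x, b)" by force
  let ?v = "rev (map (\<lambda>(x, b). (x, \<not> b)) u)"
  have "pres_eq R ([(x, \<not> b), (x, b)] @ u) ([] @ u)"
    using pres_eq.cancel[of R x "\<not> b"] by (intro pres_eq.append pres_eq.refl) simp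
  then have "pres_eq R (?v @ [(x, \<not> b), (x, b)] @ u) (?v @ [] @ u)"
    by (rule pres_eq.append[OF pres_eq.refl])
  then show ?case
    using pres_eq.trans[OF _ Cons.IH] a by simp
qed

lemma group_presented_group: "group (presented_group R)"
proof (rule groupI)
  fix A assume "A \<in> carrier (presented_group R)"
  then obtain u where u: "A = pres_class R u" by (auto simp: carrier_presented_group)
  have "pres_class R (rev (map (\<lambda>(x, b). (x, \<not> b)) u)) \<otimes>\<^bsub>presented_group R\<^esub> A
      = \<one>\<^bsub>presented_group R\<^esub>"
    by (simp add: u pres_class_eq_iff pres_eq_inverse)
  then show "\<exists>B\<in>carrier (presented_group R). B \<otimes>\<^bsub>presented_group R\<^esub> A = \<one>\<^bsub>presented_group R\<^esub>"
    using pres_class_closed by blast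
qed (auto simp: carrier_presented_group)

text \<open>
  The map between presented groups on the same generators which sends each generator to itself.
  It is well defined when the relations \<open>R\<close> hold in the target.
\<close>

definition pres_map ::
  "('a gword \<times> 'a gword) set \<Rightarrow> 'a gword set \<Rightarrow> 'a gword set" where
  "pres_map R' A = (\<Union>u\<in>A. pres_class R' u)"

lemma pres_eq_mono: "pres_eq R u v \<Longrightarrow> R \<subseteq> R' \<Longrightarrow> pres_eq R' u v"
proof (induction rule: pres_eq.induct)
  case (rel u v)
  then show ?case by (meson pres_eq.rel subsetD)
next
  case (cancel x b)
  show ?case by (rule pres_eq.cancel)
next
  case (refl u)
  show ?case by (rule pres_eq.refl)
next
  case (sym u v)
  then show ?case by (simp add: pres_eq.sym)
next
  case (trans u v w)
  then show ?case by (meson pres_eq.trans)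
next
  case (append u v u' v')
  then show ?case by (simp add: pres_eq.append)
qed

lemma pres_map_class [simp]:
  assumes "R \<subseteq> R'"
  shows "pres_map R' (pres_class R u) = pres_class R' u"
proof -
  have "pres_class R' v = pres_class R' u" if "v \<in> pres_class R u" for v
    using that assms by (simp add: in_pres_class pres_class_eq_iff pres_eq_mono)
  moreover have "u \<in> pres_class R u" by (simp add: in_pres_class)
  ultimately show ?thesis unfolding pres_map_def by blast
qed


section \<open>The groups of type \<open>I\<^sub>n\<close>\<close>

datatype node = Node1 | Node2

fun alternating :: "nat \<Rightarrow> 'a \<Rightarrow> 'a \<Rightarrow> 'a list" where
  "alternating 0 x y = []"
| "alternating (Suc n) x y = x # alternating n y x"

definition alt_word :: "nat \<Rightarrow> 'a \<Rightarrow> 'a \<Rightarrow> 'a gword" where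
  "alt_word n x y = alternating n (x, True) (y, True)"

definition braid_rels :: "nat \<Rightarrow> (node gword \<times> node gword) set" where
  "braid_rels n = {(alt_word n Node1 Node2, alt_word n Node2 Node1)}"

definition weyl_rels :: "nat \<Rightarrow> (node gword \<times> node gword) set" where
  "weyl_rels n =
     {([(Node1, True), (Node1, True)], []), ([(Node2, True), (Node2, True)], [])} \<union> braid_rels n"

definition braid_group :: "nat \<Rightarrow> node gword set monoid" where
  "braid_group n = presented_group (braid_rels n)"

definition weyl_group :: "nat \<Rightarrow> node gword set monoid" where
  "weyl_group n = presented_group (weyl_rels n)"

definition braid_to_weyl :: "nat \<Rightarrow> node gword set \<Rightarrow> node gword set" where
  "braid_to_weyl n = pres_map (weyl_rels n)"

definition pure_braid_group :: "nat \<Rightarrow> node gword set monoid" where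
  "pure_braid_group n =
     (braid_group n)\<lparr>carrier := kernel (braid_group n) (weyl_group n) (braid_to_weyl n)\<rparr>"

definition braid_gen :: "nat \<Rightarrow> node \<Rightarrow> node gword set" where
  "braid_gen n i = pres_class (braid_rels n) [(i, True)]"

definition longest_lift :: "nat \<Rightarrow> node gword set" where
  "longest_lift n = pres_class (braid_rels n) (alt_word n Node1 Node2)"

text \<open>
  The subgroup generated by the monodromies around the walls of the fixed chamber: the squares
  of \<open>s\<^sub>1\<close> and \<open>s\<^sub>2\<close> come from the two walls of codimension one and the square of the lift of
  the longest element comes from the wall of codimension two.
\<close>

definition wall_monodromy_subgroup :: "nat \<Rightarrow> node gword set set" where
  "wall_monodromy_subgroup n =
     generate (braid_group n)
       {braid_gen n Node1 [^]\<^bsub>braid_group n\<^esub> (2::nat),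
        braid_gen n Node2 [^]\<^bsub>braid_group n\<^esub> (2::nat),
        longest_lift n [^]\<^bsub>braid_group n\<^esub> (2::nat)}"

lemma group_braid_group: "group (braid_group n)"
  by (simp add: braid_group_def group_presented_group)

lemma group_weyl_group: "group (weyl_group n)"
  by (simp add: weyl_group_def group_presented_group)

lemma braid_to_weyl_class [simp]:
  "braid_to_weyl n (pres_class (braid_rels n) u) = pres_class (weyl_rels n) u"
  unfolding braid_to_weyl_def by (rule pres_map_class) (auto simp: weyl_rels_def)

lemma braid_to_weyl_hom: "group_hom (braid_group n) (weyl_group n) (braid_to_weyl n)"
proof -
  have "braid_to_weyl n \<in> hom (braid_group n) (weyl_group n)"
    by (auto simp: hom_def braid_group_def weyl_group_def carrier_presented_group)
  then show ?thesis
    by (simp add: group_hom_def group_hom_axioms_def group_braid_group group_weyl_group)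
qed

lemma braid_to_weyl_surj:
  "braid_to_weyl n ` carrier (braid_group n) = carrier (weyl_group n)"
  by (auto simp: braid_group_def weyl_group_def carrier_presented_group image_image)

lemma group_pure_braid_group: "group (pure_braid_group n)"
  unfolding pure_braid_group_def
  by (rule subgroup.subgroup_is_group[OF
        group_hom.subgroup_kernel[OF braid_to_weyl_hom] group_braid_group])

lemma alternating_snoc:
  "alternating (Suc n) x y = alternating n x y @ [if even n then x else y]"
  by (induction n arbitrary: x y) simp_all

lemma rev_alternating:
  "rev (alternating n x y) = (if odd n then alternating n x y else alternating n y x)"
proof (induction n arbitrary: x y)
  case (Suc n)
  have "rev (alternating (Suc n) x y) = rev (alternating n y x) @ [x]" by simp
  also have "\<dots> = (if even n then alternating n x y @ [x] else alternating n y x @ [x])"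
    by (simp add: Suc.IH)
  also have "\<dots> = (if even n then alternating (Suc n) x y else alternating (Suc n) y x)"
    by (simp only: alternating_snoc if_True if_False cong: if_cong)
  finally show ?case by simp
qed simp

lemma weyl_rels_cancel: "pres_eq (weyl_rels n) [(i, True), (i, True)] []"
  by (cases i) (auto intro!: pres_eq.rel simp: weyl_rels_def)

lemma weyl_rels_rev:
  assumes "\<forall>a\<in>set u. snd a"
  shows "pres_eq (weyl_rels n) (u @ rev u) []"
  using assms
proof (induction u rule: rev_induct)
  case Nil
  show ?case by (simp add: pres_eq.refl)
next
  case (snoc a u)
  then obtain i where a: "a = (i, True)" by (cases a) auto
  have "pres_eq (weyl_rels n) (u @ [a, a] @ rev u) (u @ [] @ rev u)"
    unfolding a by (intro pres_eq.append pres_eq.refl weyl_rels_cancel)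
  then show ?case using pres_eq.trans[of "weyl_rels n" _ "u @ rev u" "[]"] snoc by simp
qed

lemma weyl_rels_longest:
  "pres_eq (weyl_rels n) (alt_word n Node1 Node2 @ alt_word n Node1 Node2) []"
proof -
  let ?u = "alt_word n Node1 Node2" and ?v = "alt_word n Node2 Node1"
  have "set (alternating m a b) \<subseteq> {a, b}" for m and a b :: "node \<times> bool"
    by (induction m arbitrary: a b) (simp, fastforce)
  then have "\<forall>a\<in>set ?u. snd a" by (force simp: alt_word_def)
  then have 1: "pres_eq (weyl_rels n) (?u @ rev ?u) []" by (rule weyl_rels_rev)
  have "rev ?u = ?u \<or> rev ?u = ?v" by (simp add: alt_word_def rev_alternating)
  moreover have "pres_eq (weyl_rels n) ?u ?v"
    by (intro pres_eq.rel) (simp add: weyl_rels_def braid_rels_def)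
  ultimately have "pres_eq (weyl_rels n) (?u @ ?u) (?u @ rev ?u)"
    by (metis pres_eq.append pres_eq.refl)
  then show ?thesis using 1 by (rule pres_eq.trans)
qed

lemma wall_monodromy_subgroup:
  "subgroup (wall_monodromy_subgroup n) (pure_braid_group n)"
proof -
  interpret B: group "braid_group n" by (rule group_braid_group)
  interpret h: group_hom "braid_group n" "weyl_group n" "braid_to_weyl n"
    by (rule braid_to_weyl_hom)
  let ?P = "kernel (braid_group n) (weyl_group n) (braid_to_weyl n)"
  have sq: "pres_class (braid_rels n) u [^]\<^bsub>braid_group n\<^esub> (2::nat)
          = pres_class (braid_rels n) (u @ u)" for u
    by (simp add: numeral_2_eq_2 braid_group_def)
  have sub: "{braid_gen n Node1 [^]\<^bsub>braid_group n\<^esub> (2::nat),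
        braid_gen n Node2 [^]\<^bsub>braid_group n\<^esub> (2::nat),
        longest_lift n [^]\<^bsub>braid_group n\<^esub> (2::nat)} \<subseteq> ?P"
    unfolding braid_gen_def longest_lift_def sq
    using weyl_rels_cancel weyl_rels_longest
    by (simp add: kernel_def weyl_group_def pres_class_eq_iff) (simp add: braid_group_def)
  have P: "subgroup ?P (braid_group n)" by (rule h.subgroup_kernel)
  have "wall_monodromy_subgroup n \<subseteq> ?P"
    unfolding wall_monodromy_subgroup_def by (rule B.generate_subgroup_incl[OF sub P])
  moreover have "subgroup (wall_monodromy_subgroup n) (braid_group n)"
    unfolding wall_monodromy_subgroup_def
    using sub subgroup.subset[OF P] by (intro B.generate_is_subgroup) blast
  ultimately show ?thesis
    unfolding pure_braid_group_def by (intro B.subgroup_incl[OF _ P])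
qed

end

(*
  Index the n lines of the arrangement by residues k mod n, so that the generators s_1, s_2 are
  the reflections in the lines 0 and 1, and the reflection in the line i moves the line k to the
  line 2i - k. Counting with signs how often a braid crosses each line gives a crossed
  homomorphism from the braid group to Q^n, which restricts to a homomorphism on the pure braid
  group. The conjugates of s_1^2 and s_2^2 are sent to 2 e_k for every line k, so the images of a
  generating set of the pure braid group span Q^n.
*)
theory Submission
  imports Defs HOL.Rat HOL.Vector_Spaces "HOL-Number_Theory.Cong" "HOL-Library.Function_Algebras"
begin

section \<open>Lines, reflections and signed crossings\<close>

text \<open>Lines are labelled by all integers, and labels congruent mod n name the same line. This
  keeps the action independent of n; the congruence lemmas below justify the labelling.\<close>

primrec line :: "node \<Rightarrow> int" where
  "line Node1 = 0"
| "line Node2 = 1"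

text \<open>Words act on lines from the right. A generator and its inverse act by the same reflection.\<close>

primrec reflect :: "node gword \<Rightarrow> int \<Rightarrow> int" where
  "reflect [] k = k"
| "reflect (a # u) k = reflect u (2 * line (fst a) - k)"

text \<open>The line k is followed along the word: a letter contributes its sign exactly when its
  mirror is the current image of k.\<close>

primrec crossing :: "nat \<Rightarrow> node gword \<Rightarrow> int \<Rightarrow> rat" where
  "crossing n [] k = 0"
| "crossing n (a # u) k =
     (if int n dvd k - line (fst a) then if snd a then 1 else - 1 else 0)
       + crossing n u (2 * line (fst a) - k)"

lemma reflect_append [simp]: "reflect (u @ v) k = reflect v (reflect u k)"
  by (induction u arbitrary: k) simp_all

lemma crossing_append [simp]:
  "crossing n (u @ v) k = crossing n u k + crossing n v (reflect u k)"
  by (induction u arbitrary: k) simp_all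

lemma reflect_cong: "[k = l] (mod m) \<Longrightarrow> [reflect u k = reflect u l] (mod m)"
proof (induction u arbitrary: k l)
  case (Cons a u)
  show ?case using Cons.IH[OF cong_diff[OF cong_refl Cons.prems]] by simp
qed simp

lemma dvd_diff_cong: "[k = l] (mod m) \<Longrightarrow> m dvd k - i \<longleftrightarrow> m dvd l - (i :: int)"
  by (simp only: flip: cong_iff_dvd_diff) (meson cong_sym cong_trans)

lemma crossing_cong: "[k = l] (mod int n) \<Longrightarrow> crossing n u k = crossing n u l"
proof (induction u arbitrary: k l)
  case (Cons a u)
  show ?case
    using Cons.IH[OF cong_diff[OF cong_refl Cons.prems]] dvd_diff_cong[OF Cons.prems] by simp
qed simp

section \<open>Invariance under the defining relations\<close>

lemma alt_word_Suc: "alt_word (Suc m) x y = (x, True) # alt_word m y x"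
  by (simp add: alt_word_def)

lemma reflect_alt_word:
  "reflect (alt_word m Node1 Node2) k = (if even m then k + int m else 1 - k - int m)"
  "reflect (alt_word m Node2 Node1) k = (if even m then k - int m else 1 - k + int m)"
proof (induction m arbitrary: k)
  case 0
  { case 1 show ?case by (simp add: alt_word_def) }
  { case 2 show ?case by (simp add: alt_word_def) }
next
  case (Suc m)
  { case 1 show ?case by (simp add: alt_word_Suc Suc) }
  { case 2 show ?case by (simp add: alt_word_Suc Suc) }
qed

text \<open>The letter at position j, counted from 0, is the one at which the line -j (first word)
  or 1 + j (second word) is crossed.\<close>

lemma crossing_alt_word:
  "crossing n (alt_word m Node1 Node2) k = (\<Sum>j<m. of_bool (int n dvd k + int j))"
  "crossing n (alt_word m Node2 Node1) k = (\<Sum>j<m. of_bool (int n dvd k - 1 - int j))"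
proof (induction m arbitrary: k)
  case 0
  { case 1 show ?case by (simp add: alt_word_def) }
  { case 2 show ?case by (simp add: alt_word_def) }
next
  case (Suc m)
  { case 1
    have "int n dvd - k - 1 - int j \<longleftrightarrow> int n dvd k + int (Suc j)" for j
    proof -
      have "- k - 1 - int j = - (k + int (Suc j))" by simp
      then show ?thesis by (simp only: dvd_minus_iff)
    qed
    then show ?case unfolding alt_word_Suc sum.lessThan_Suc_shift by (simp add: Suc) }
  { case 2
    have "int n dvd 2 - k + int j \<longleftrightarrow> int n dvd k - 1 - int (Suc j)" for j
    proof -
      have "2 - k + int j = - (k - 1 - int (Suc j))" by simp
      then show ?thesis by (simp only: dvd_minus_iff)
    qed
    then show ?case unfolding alt_word_Suc sum.lessThan_Suc_shift by (simp add: Suc) }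
qed

lemma reflect_braid_rel:
  "[reflect (alt_word n Node1 Node2) k = reflect (alt_word n Node2 Node1) k] (mod int n)"
  by (simp add: reflect_alt_word cong_iff_dvd_diff)

lemma crossing_braid_rel:
  "crossing n (alt_word n Node1 Node2) k = crossing n (alt_word n Node2 Node1) k"
proof -
  \<comment> \<open>The two words of length n cross the same lines in opposite order: 1 + (n - 1 -
    j) is congruent to -j.\<close>
  have "int n dvd k - 1 - int (n - Suc j) \<longleftrightarrow> int n dvd k + int j" if "j < n" for j
  proof -
    have "k - 1 - int (n - Suc j) = k + int j - int n" using that by simp
    then show ?thesis by (simp only: dvd_diff_left_iff dvd_refl)
  qed
  then have "(\<Sum>j<n. of_bool (int n dvd k + int j) :: rat)
      = (\<Sum>j<n. of_bool (int n dvd k - 1 - int (n - Suc j)))"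
    by (intro sum.cong) simp_all
  also have "\<dots> = (\<Sum>j<n. of_bool (int n dvd k - 1 - int j))"
    by (rule sum.nat_diff_reindex)
  finally show ?thesis unfolding crossing_alt_word .
qed

lemma reflect_pres_eq_weyl:
  "pres_eq (weyl_rels n) u v \<Longrightarrow> [reflect u k = reflect v k] (mod int n)"
proof (induction arbitrary: k rule: pres_eq.induct)
  case (rel u v)
  then show ?case
    by (auto simp: weyl_rels_def braid_rels_def intro: reflect_braid_rel)
next
  case (append u v u' v')
  then show ?case by (metis reflect_append reflect_cong cong_trans)
qed (auto intro: cong_sym cong_trans)

lemma reflect_pres_eq_braid:
  "pres_eq (braid_rels n) u v \<Longrightarrow> [reflect u k = reflect v k] (mod int n)"
  by (rule reflect_pres_eq_weyl) (auto elim: pres_eq_mono simp: weyl_rels_def)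

text \<open>Unlike the action, crossing numbers do not descend to the Weyl group: squares of
  generators have nonzero crossing numbers. In a cancelling pair both letters meet the same line,
  with opposite signs.\<close>

lemma crossing_pres_eq:
  "pres_eq (braid_rels n) u v \<Longrightarrow> crossing n u k = crossing n v k"
proof (induction arbitrary: k rule: pres_eq.induct)
  case (rel u v)
  then show ?case by (simp add: braid_rels_def crossing_braid_rel)
next
  case (cancel x b)
  have "int n dvd 2 * line x - k - line x \<longleftrightarrow> int n dvd k - line x"
    using dvd_minus_iff[of "int n" "k - line x"] by (simp add: algebra_simps)
  then show ?case by simp
next
  case (append u v u' v')
  then show ?case using reflect_pres_eq_braid crossing_cong by (metis crossing_append)
qed auto

section \<open>The homomorphism on pure braids\<close>

definition braid_crossing :: "nat \<Rightarrow> node gword set \<Rightarrow> int \<Rightarrow> rat" where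
  "braid_crossing n A = crossing n (SOME u. u \<in> A)"

lemma braid_crossing_class [simp]:
  "braid_crossing n (pres_class (braid_rels n) u) = crossing n u"
proof -
  have "u \<in> pres_class (braid_rels n) u" by (simp add: in_pres_class)
  then have "(SOME v. v \<in> pres_class (braid_rels n) u) \<in> pres_class (braid_rels n) u"
    by (rule someI)
  then show ?thesis
    unfolding braid_crossing_def by (auto simp: pres_class_def crossing_pres_eq)
qed

lemma carrier_pure_braid_group:
  "carrier (pure_braid_group n) =
     {pres_class (braid_rels n) u | u. pres_eq (weyl_rels n) u []}"
proof -
  have "\<one>\<^bsub>weyl_group n\<^esub> = pres_class (weyl_rels n) []" by (simp add: weyl_group_def)
  then have "A \<in> carrier (pure_braid_group n) \<longleftrightarrow>
      (\<exists>u. A = pres_class (braid_rels n) u \<and> pres_class (weyl_rels n) u = pres_class (weyl_rels n) [])"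
    for A
    by (simp add: pure_braid_group_def kernel_def braid_group_def carrier_presented_group)
      (metis braid_to_weyl_class rangeE rangeI)
  then show ?thesis by (simp add: set_eq_iff[of "carrier _"] pres_class_eq_iff)
qed

text \<open>A pure braid fixes every line mod n, so the twist in \<open>crossing_append\<close>
  disappears.\<close>

lemma braid_crossing_mult:
  assumes "A \<in> carrier (pure_braid_group n)" "B \<in> carrier (pure_braid_group n)"
  shows "braid_crossing n (A \<otimes>\<^bsub>pure_braid_group n\<^esub> B) = braid_crossing n A + braid_crossing n B"
proof -
  obtain u v where u: "A = pres_class (braid_rels n) u" "pres_eq (weyl_rels n) u []"
    and v: "B = pres_class (braid_rels n) v"
    using assms by (auto simp: carrier_pure_braid_group)
  have "A \<otimes>\<^bsub>pure_braid_group n\<^esub> B = pres_class (braid_rels n) (u @ v)"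
    by (simp add: u v pure_braid_group_def braid_group_def)
  moreover have "crossing n v (reflect u k) = crossing n v k" for k
    using reflect_pres_eq_weyl[OF u(2)] by (intro crossing_cong) simp
  ultimately show ?thesis by (simp add: u v fun_eq_iff)
qed

lemma braid_crossing_one: "braid_crossing n \<one>\<^bsub>pure_braid_group n\<^esub> = 0"
  by (simp add: pure_braid_group_def braid_group_def fun_eq_iff)

text \<open>For functions on the integers, this space contains Q^n as the n-periodic functions,
  among which all crossing functions lie.\<close>

interpretation ratfun: vector_space "\<lambda>(r :: rat) f (x :: 'a). r * f x"
  by unfold_locales (auto simp: algebra_simps)

lemma braid_crossing_generate:
  assumes "X \<subseteq> carrier (pure_braid_group n)" "A \<in> generate (pure_braid_group n) X"
  shows "braid_crossing n A \<in> ratfun.span (braid_crossing n ` X)"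
proof -
  interpret P: group "pure_braid_group n" by (rule group_pure_braid_group)
  show ?thesis using assms(2)
  proof (induction rule: generate.induct)
    case one
    show ?case unfolding braid_crossing_one by (rule ratfun.span_zero)
  next
    case (incl h)
    then show ?case by (simp add: ratfun.span_base)
  next
    case (inv h)
    then have h: "h \<in> carrier (pure_braid_group n)" using assms(1) by auto
    have "braid_crossing n (inv\<^bsub>pure_braid_group n\<^esub> h) + braid_crossing n h = 0"
      using h by (simp flip: braid_crossing_mult add: braid_crossing_one)
    then have "braid_crossing n (inv\<^bsub>pure_braid_group n\<^esub> h) = - braid_crossing n h"
      by (rule eq_neg_iff_add_eq_0[THEN iffD2])
    then show ?case using inv by (metis imageI ratfun.span_base ratfun.span_neg)
  next
    case (eng h1 h2)
    then have "h1 \<in> carrier (pure_braid_group n)" "h2 \<in> carrier (pure_braid_group n)"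
      using P.generate_in_carrier[OF assms(1)] by auto
    then show ?case using eng by (simp only: braid_crossing_mult ratfun.span_add)
  qed
qed

section \<open>Independent images and the bound on generators\<close>

text \<open>The basis vector of the line -m. The sign fits the words starting with
  \<open>Node1\<close>: by \<open>reflect_alt_word\<close>, the one of length m carries the line -m
  to the mirror of the letter that would come next.\<close>

definition line_indicator :: "nat \<Rightarrow> nat \<Rightarrow> int \<Rightarrow> rat" where
  "line_indicator n m k = of_bool (int n dvd k + int m)"

lemma line_indicator_eq:
  assumes "i < n" "j < n"
  shows "line_indicator n i (- int j) = of_bool (i = j)"
proof -
  have "int n dvd int i - int j \<longleftrightarrow> i = j"
    using assms by (simp flip: cong_iff_dvd_diff add: cong_int_iff) (auto dest: cong_less_modulus_unique_nat)
  then show ?thesis by (simp add: line_indicator_def)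
qed

lemma inj_on_line_indicator: "inj_on (line_indicator n) {..<n}"
proof (rule inj_onI)
  fix i j assume "i \<in> {..<n}" "j \<in> {..<n}" "line_indicator n i = line_indicator n j"
  then have "of_bool (i = j) = (1 :: rat)"
    using line_indicator_eq[of i n j] line_indicator_eq[of j n j] by simp
  then show "i = j" by (simp split: if_splits)
qed

text \<open>Evaluation at -j isolates the coefficient of the j-th indicator, so evaluations form a
  dual family.\<close>

lemma independent_line_indicator: "ratfun.independent (line_indicator n ` {..<n})"
proof (subst ratfun.independent_explicit_finite_subsets, intro allI impI ballI)
  fix S and c :: "(int \<Rightarrow> rat) \<Rightarrow> rat" and f
  assume S: "S \<subseteq> line_indicator n ` {..<n}" "finite S"
    and sum: "(\<Sum>g\<in>S. (\<lambda>x. c g * g x)) = 0" and f: "f \<in> S"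
  obtain j where j: "j < n" "f = line_indicator n j" using S f by auto
  have "c g * g (- int j) = (if g = f then c f else 0)" if g: "g \<in> S" for g
  proof -
    obtain i where i: "i < n" "g = line_indicator n i" using S g by auto
    then have "g = f \<longleftrightarrow> i = j"
      using j inj_onD[OF inj_on_line_indicator[of n], of i j] by auto
    moreover have "g (- int j) = of_bool (i = j)" using i j line_indicator_eq by simp
    ultimately show ?thesis by (cases "g = f") simp_all
  qed
  then have "(\<Sum>g\<in>S. c g * g (- int j)) = (\<Sum>g\<in>S. if g = f then c f else 0)"
    by (rule sum.cong[OF HOL.refl])
  then have "(\<Sum>g\<in>S. c g * g (- int j)) = c f"
    using S(2) f by (simp only: sum.delta if_True)
  moreover have "(\<Sum>g\<in>S. c g * g (- int j)) = (\<Sum>g\<in>S. (\<lambda>x. c g * g x)) (- int j)"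
    using S(2) by (induction rule: finite_induct) auto
  ultimately show "c f = 0" unfolding sum by simp
qed

text \<open>The braid is a conjugate of the square of a generator: \<open>?u\<close> brings the line
  -m to the mirror of \<open>?x\<close>, the square crosses it twice, and the way back undoes the
  crossings of \<open>?u\<close>.\<close>

lemma pure_braid_around_line:
  "\<exists>A \<in> carrier (pure_braid_group n). braid_crossing n A = (\<lambda>k. 2 * line_indicator n m k)"
proof -
  let ?inv = "\<lambda>u. rev (map (\<lambda>(x, b). (x, \<not> b)) u) :: node gword"
  let ?u = "alt_word m Node1 Node2"
  let ?x = "if even m then Node1 else Node2"
  let ?w = "?u @ [(?x, True), (?x, True)] @ ?inv ?u"
  \<comment> \<open>\<open>pres_eq_inverse\<close> cancels on the left, so it is applied to the
    inverse word. \<open>R\<close> stays arbitrary to serve both the Weyl and the braid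
    relations.\<close>
  have inv: "pres_eq R (?u @ ?inv ?u) []" for R
    using pres_eq_inverse[of R "?inv ?u"] by (simp add: rev_map o_def case_prod_unfold)
  have "pres_eq (weyl_rels n) ?w (?u @ [] @ ?inv ?u)"
    by (intro pres_eq.append pres_eq.refl weyl_rels_cancel)
  then have w: "pres_eq (weyl_rels n) ?w []"
    using inv by (simp add: pres_eq.trans[OF _ inv])
  have "crossing n ?w k = 2 * line_indicator n m k" for k
  proof -
    have c: "crossing n ?u k + crossing n (?inv ?u) (reflect ?u k) = 0"
      using crossing_pres_eq[OF inv, where k = k] by simp
    have x: "crossing n [(?x, True), (?x, True)] (reflect ?u k) = 2 * line_indicator n m k"
      using dvd_minus_iff[of "int n" "k + int m"]
      by (simp add: reflect_alt_word line_indicator_def algebra_simps)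
    \<comment> \<open>The square fixes each label exactly, so the return word starts at
      \<open>reflect ?u k\<close>, as in \<open>c\<close>.\<close>
    have r: "reflect [(?x, True), (?x, True)] l = l" for l by simp
    show ?thesis using c x unfolding crossing_append r by linarith
  qed
  then have "braid_crossing n (pres_class (braid_rels n) ?w) = (\<lambda>k. 2 * line_indicator n m k)"
    unfolding braid_crossing_class by (rule ext)
  moreover have "pres_class (braid_rels n) ?w \<in> carrier (pure_braid_group n)"
    using w unfolding carrier_pure_braid_group by blast
  ultimately show ?thesis by (rule bexI)
qed

lemma card_generators_pure_braid_group:
  assumes X: "X \<subseteq> carrier (pure_braid_group n)"
    and gen: "generate (pure_braid_group n) X = carrier (pure_braid_group n)"
    and fin: "finite X"
  shows "n \<le> card X"
proof -
  have "line_indicator n m \<in> ratfun.span (braid_crossing n ` X)" for m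
  proof -
    obtain A where "A \<in> generate (pure_braid_group n) X"
      and A: "braid_crossing n A = (\<lambda>k. 2 * line_indicator n m k)"
      using pure_braid_around_line[of n m] unfolding gen[symmetric] by (elim bexE)
    then have "(\<lambda>k. 2 * line_indicator n m k) \<in> ratfun.span (braid_crossing n ` X)"
      using braid_crossing_generate[OF X, of A] by simp
    \<comment> \<open>Rational coefficients allow the factor 2 to be removed.\<close>
    from ratfun.span_scale[OF this, of "1/2"] show ?thesis by simp
  qed
  then have "card (line_indicator n ` {..<n}) \<le> card (braid_crossing n ` X)"
    using fin ratfun.independent_span_bound[OF _ independent_line_indicator] by blast
  also have "\<dots> \<le> card X" by (rule card_image_le[OF fin])
  finally show ?thesis by (simp add: card_image inj_on_line_indicator)
qed

theorem corollary3p15: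
  fixes n :: nat
  assumes "n \<ge> 2"
  shows "(\<forall>X. X \<subseteq> carrier (pure_braid_group n) \<and>
              generate (pure_braid_group n) X = carrier (pure_braid_group n) \<longrightarrow>
              infinite X \<or> n \<le> card X) \<and>
         (n \<ge> 4 \<longrightarrow> wall_monodromy_subgroup n \<noteq> carrier (pure_braid_group n))"
proof (intro conjI impI notI allI)
  fix X
  assume "X \<subseteq> carrier (pure_braid_group n) \<and>
    generate (pure_braid_group n) X = carrier (pure_braid_group n)"
  then show "infinite X \<or> n \<le> card X" using card_generators_pure_braid_group by blast
next
  \<comment> \<open>Equality would make the at most three generators of the wall subgroup generate
    the whole pure braid group, against the bound.\<close>
  assume "n \<ge> 4" and K: "wall_monodromy_subgroup n = carrier (pure_braid_group n)"
  interpret B: group "braid_group n" by (rule group_braid_group)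
  interpret h: group_hom "braid_group n" "weyl_group n" "braid_to_weyl n"
    by (rule braid_to_weyl_hom)
  let ?S = "{braid_gen n Node1 [^]\<^bsub>braid_group n\<^esub> (2::nat),
        braid_gen n Node2 [^]\<^bsub>braid_group n\<^esub> (2::nat),
        longest_lift n [^]\<^bsub>braid_group n\<^esub> (2::nat)}"
  have S: "?S \<subseteq> carrier (pure_braid_group n)"
    unfolding K[symmetric] wall_monodromy_subgroup_def by (auto intro: generate.incl)
  \<comment> \<open>The wall subgroup is generated inside the braid group, the bound concerns
    generation inside the pure braid group; for subsets of a subgroup the two agree.\<close>
  have "generate (pure_braid_group n) ?S = generate (braid_group n) ?S"
    unfolding pure_braid_group_def
    by (rule B.generate_consistent[OF _ h.subgroup_kernel])
      (use S in \<open>unfold pure_braid_group_def, simp\<close>)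
  then have "generate (pure_braid_group n) ?S = carrier (pure_braid_group n)"
    unfolding K[symmetric] wall_monodromy_subgroup_def .
  then have "n \<le> card ?S" using card_generators_pure_braid_group[OF S] by blast
  moreover have "card ?S \<le> 3" by (simp add: card_insert_if)
  ultimately show False using \<open>n \<ge> 4\<close> by simp
qed

end
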